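(* The class of $(\overline{2P_1+P_2},\,P_2+P_4)$-free graphs has unbounded clique-width.
   Context: All graphs are finite, simple and undirected. For graphs $H_1,\dots,H_p$, a graph $G$ is $(H_1,\dots,H_p)$-free if no induced subgraph of $G$ is isomorphic to any $H_i$. $P_r$ denotes the path on $r$ vertices; $G+H$ is the disjoint union of $G$ and $H$, and $rG$ is the disjoint union of $r$ copies of $G$; $\overline{G}$ is the complement of $G$. Thus $\overline{2P_1+P_2}$ is the diamond ($K_4$ minus an edge). The clique-width of a graph $G$ is the minimum number of labels needed to construct $G$ using the operations: (1) create a single vertex with label $i$; (2) take the disjoint union of two labelled graphs; (3) add all edges between vertices with label $i$ and vertices with label $j$ ($i\ne j$); (4) rename label $i$ to $j$. A class of graphs has bounded clique-width if there is a constant $c$ such that every graph in the class has clique-width at most $c$; otherwise it has unbounded clique-width. *)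

theory Defs
  imports Main
begin

section \<open>Finite simple graphs\<close>

record 'a ugraph =
  verts :: "'a set"
  edges :: "'a set set"

definition simple_graph :: "'a ugraph \<Rightarrow> bool" where
  "simple_graph G \<longleftrightarrow> finite (verts G) \<and> (\<forall>e\<in>edges G. e \<subseteq> verts G \<and> card e = 2)"

definition graph_iso :: "'a ugraph \<Rightarrow> 'b ugraph \<Rightarrow> bool" where
  "graph_iso G H \<longleftrightarrow> (\<exists>f. bij_betw f (verts G) (verts H) \<and>
     (\<forall>u\<in>verts G. \<forall>v\<in>verts G. {u, v} \<in> edges G \<longleftrightarrow> {f u, f v} \<in> edges H))"

definition induced_subgraph :: "'a ugraph \<Rightarrow> 'a set \<Rightarrow> 'a ugraph" where
  "induced_subgraph G S = \<lparr>verts = S, edges = {e \<in> edges G. e \<subseteq> S}\<rparr>"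

definition graph_free :: "'b ugraph \<Rightarrow> 'a ugraph \<Rightarrow> bool" where
  "graph_free H G \<longleftrightarrow> \<not> (\<exists>S\<subseteq>verts G. graph_iso (induced_subgraph G S) H)"

definition path_graph :: "nat \<Rightarrow> nat ugraph" where
  "path_graph r = \<lparr>verts = {..<r}, edges = {{i, Suc i} | i. Suc i < r}\<rparr>"

definition disjoint_union :: "'a ugraph \<Rightarrow> 'b ugraph \<Rightarrow> ('a + 'b) ugraph" where
  "disjoint_union G H =
     \<lparr>verts = Inl ` verts G \<union> Inr ` verts H,
      edges = (\<lambda>e. Inl ` e) ` edges G \<union> (\<lambda>e. Inr ` e) ` edges H\<rparr>"

definition copies :: "nat \<Rightarrow> 'a ugraph \<Rightarrow> (nat \<times> 'a) ugraph" where
  "copies r G =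
     \<lparr>verts = {..<r} \<times> verts G, edges = {Pair i ` e | i e. i < r \<and> e \<in> edges G}\<rparr>"

definition complement_graph :: "'a ugraph \<Rightarrow> 'a ugraph" where
  "complement_graph G =
     \<lparr>verts = verts G, edges = {e. e \<subseteq> verts G \<and> card e = 2 \<and> e \<notin> edges G}\<rparr>"


section \<open>Clique-width\<close>

text \<open>
  \<open>cw_constructible k G l\<close>: the graph \<open>G\<close>, with vertex \<open>v\<close> labelled \<open>l v\<close>, can be built
  using labels from \<open>{1..k}\<close> only.  The values of \<open>l\<close> outside \<open>verts G\<close> are irrelevant.
  Operands of a disjoint union are required to have disjoint vertex sets; since the names
  of vertices are arbitrary, this is the disjoint union up to isomorphism.
\<close>

inductive cw_constructible :: "nat \<Rightarrow> 'a ugraph \<Rightarrow> ('a \<Rightarrow> nat) \<Rightarrow> bool" for k :: nat where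
  vertex:
    "i \<in> {1..k} \<Longrightarrow> cw_constructible k \<lparr>verts = {v}, edges = {}\<rparr> (\<lambda>_. i)"
| union:
    "cw_constructible k G l \<Longrightarrow> cw_constructible k H m \<Longrightarrow> verts G \<inter> verts H = {} \<Longrightarrow>
     cw_constructible k
       \<lparr>verts = verts G \<union> verts H, edges = edges G \<union> edges H\<rparr>
       (\<lambda>v. if v \<in> verts G then l v else m v)"
| join:
    "cw_constructible k G l \<Longrightarrow> i \<in> {1..k} \<Longrightarrow> j \<in> {1..k} \<Longrightarrow> i \<noteq> j \<Longrightarrow>
     cw_constructible k
       \<lparr>verts = verts G,
        edges = edges G \<union> {{u, v} | u v. u \<in> verts G \<and> v \<in> verts G \<and> l u = i \<and> l v = j}\<rparr>
       l"
| relabel: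
    "cw_constructible k G l \<Longrightarrow> i \<in> {1..k} \<Longrightarrow> j \<in> {1..k} \<Longrightarrow>
     cw_constructible k G (\<lambda>v. if l v = i then j else l v)"

text \<open>
  The set below is nonempty for every simple graph with at least one vertex
  (\<open>cw_constructible_exists\<close>).  The graph without vertices gets clique-width 0, since
  \<open>Inf {} = 0\<close> on the natural numbers.
\<close>

definition clique_width :: "'a ugraph \<Rightarrow> nat" where
  "clique_width G = Inf {k. \<exists>l. cw_constructible k G l}"

definition bounded_clique_width :: "'a ugraph set \<Rightarrow> bool" where
  "bounded_clique_width \<G> \<longleftrightarrow> (\<exists>c. \<forall>G\<in>\<G>. clique_width G \<le> c)"

lemma cw_constructible_simple_graph:
  "cw_constructible k G l \<Longrightarrow> simple_graph G \<and> verts G \<noteq> {} \<and> l ` verts G \<subseteq> {1..k}"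
proof (induction rule: cw_constructible.induct)
  case (join G l i j)
  have "{u, v} \<subseteq> verts G \<and> card {u, v} = 2"
    if "u \<in> verts G" "v \<in> verts G" "l u = i" "l v = j" for u v
  proof -
    have "u \<noteq> v" using that join.hyps by auto
    then show ?thesis using that by simp
  qed
  then show ?case
    using join.IH by (simp add: simple_graph_def) blast
qed (auto simp: simple_graph_def)

lemma cw_constructible_edgeless:
  assumes "finite V" "V \<noteq> {}" "l ` V \<subseteq> {1..k}"
  shows "\<exists>m. cw_constructible k \<lparr>verts = V, edges = {}\<rparr> m \<and> (\<forall>v\<in>V. m v = l v)"
  using assms
proof (induction V rule: finite_ne_induct)
  case (singleton v)
  then show ?case
    by (intro exI[of _ "\<lambda>_. l v"]) (auto intro: cw_constructible.vertex)
next
  case (insert v V)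
  then obtain m where m: "cw_constructible k \<lparr>verts = V, edges = {}\<rparr> m" "\<forall>w\<in>V. m w = l w"
    by auto
  have "cw_constructible k \<lparr>verts = {v}, edges = {}\<rparr> (\<lambda>_. l v)"
    using insert.prems by (intro cw_constructible.vertex) auto
  from cw_constructible.union[OF this m(1)] insert.hyps m(2) show ?case
    by (intro exI[of _ "\<lambda>w. if w \<in> {v} then l v else m w"]) auto
qed

lemma cw_constructible_exists:
  assumes G: "simple_graph G" and ne: "verts G \<noteq> {}"
  shows "\<exists>k l. cw_constructible k G l"
proof -
  define V where "V = verts G"
  have fin: "finite V" and edges: "\<And>e. e \<in> edges G \<Longrightarrow> e \<subseteq> V \<and> card e = 2"
    using G by (auto simp: simple_graph_def V_def)
  have "finite (edges G)"
    by (rule finite_subset[of _ "Pow V"]) (use fin edges in auto)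
  from fin obtain h where h: "bij_betw h V {1..card V}"
    using ex_bij_betw_finite_nat[OF fin] finite_same_card_bij[OF fin, of "{1..card V}"] by auto
  obtain m where m: "cw_constructible (card V) \<lparr>verts = V, edges = {}\<rparr> m" "\<forall>v\<in>V. m v = h v"
    using cw_constructible_edgeless[of V h "card V"] fin ne h
    by (auto simp: V_def bij_betw_def)
  have inj: "inj_on m V" and rng: "m ` V \<subseteq> {1..card V}"
    using h m(2) by (auto simp: bij_betw_def inj_on_def)
  have "cw_constructible (card V) \<lparr>verts = V, edges = E\<rparr> m" if "E \<subseteq> edges G" for E
    using finite_subset[OF that \<open>finite (edges G)\<close>] that
  proof (induction E rule: finite_induct)
    case empty
    then show ?case using m(1) by simp
  next
    case (insert e E)
    obtain u v where e: "e = {u, v}" "u \<noteq> v" "u \<in> V" "v \<in> V"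
      using edges[of e] insert.prems by (auto simp: card_2_iff)
    have "{{x, y} | x y. x \<in> V \<and> y \<in> V \<and> m x = m u \<and> m y = m v} = {e}"
      using e inj by (auto simp: inj_on_def)
    moreover have "m u \<in> {1..card V}" "m v \<in> {1..card V}"
      using e rng by blast+
    moreover have "m u \<noteq> m v"
      using e inj by (simp add: inj_on_eq_iff)
    ultimately show ?case
      using cw_constructible.join[of "card V" "\<lparr>verts = V, edges = E\<rparr>" m "m u" "m v"] insert
      by simp
  qed
  from this[of "edges G"] have "cw_constructible (card V) G m"
    by (cases G) (simp add: V_def)
  then show ?thesis by blast
qed

end

theory Submission imports Defs "HOL-Library.Nat_Bijection" begin

text \<open>
  Glue a triangle onto every edge of \<open>K\<^bsub>n,n\<^esub>\<close>. Every edge lies in exactly one triangle, so the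
  graph is diamond-free. An edge of \<open>K\<^bsub>n,n\<^esub>\<close> dominates everything but an independent set of
  triangle apexes, and an edge at an apex dominates everything but a disjoint union of stars, so
  there is no induced \<open>P\<^sub>2 + P\<^sub>4\<close>. A construction with \<open>k\<close> labels yields a vertex set \<open>X\<close> that
  contains between a third and two thirds of the rows (one side of \<open>K\<^bsub>n,n\<^esub>\<close>) and whose vertices have at most \<open>k\<close>
  different neighbourhoods outside \<open>X\<close>. Hence all but a few rows and columns lie, together with
  all their apexes, on one side of \<open>X\<close>; but a column cannot agree with both a row inside and a
  row outside.
\<close>

section \<open>Balanced cuts from clique-width constructions\<close>

text \<open>For finite graphs: the vertices of \<open>X\<close> have at most \<open>k\<close>
  distinct neighbourhoods outside \<open>X\<close>. The form with systems of representatives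
  \<open>S\<close> bounds any explicit pairwise distinguished set at once.\<close>

definition cut_types_le :: "'a ugraph \<Rightarrow> nat \<Rightarrow> 'a set \<Rightarrow> bool" where
  "cut_types_le G k X \<longleftrightarrow> (\<forall>S\<subseteq>X.
     (\<forall>u\<in>S. \<forall>v\<in>S. u \<noteq> v \<longrightarrow> (\<exists>w\<in>verts G - X. ({u, w} \<in> edges G) \<noteq> ({v, w} \<in> edges G)))
     \<longrightarrow> card S \<le> k)"

text \<open>That \<open>m\<close> refines \<open>l\<close> is what carries the induction below through joins.\<close>

definition cut_labels :: "nat \<Rightarrow> 'a ugraph \<Rightarrow> ('a \<Rightarrow> nat) \<Rightarrow> 'a set \<Rightarrow> ('a \<Rightarrow> nat) \<Rightarrow> bool" where
  "cut_labels k G l X m \<longleftrightarrow> X \<subseteq> verts G \<and> m ` X \<subseteq> {1..k} \<and>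
    (\<forall>u\<in>X. \<forall>v\<in>X. m u = m v \<longrightarrow>
       l u = l v \<and> (\<forall>w\<in>verts G - X. {u, w} \<in> edges G \<longleftrightarrow> {v, w} \<in> edges G))"

lemma cut_labelsD:
  assumes "cut_labels k G l X m"
  shows "X \<subseteq> verts G" "m ` X \<subseteq> {1..k}"
    and "\<And>u v. u \<in> X \<Longrightarrow> v \<in> X \<Longrightarrow> m u = m v \<Longrightarrow> l u = l v"
    and "\<And>u v w. u \<in> X \<Longrightarrow> v \<in> X \<Longrightarrow> m u = m v \<Longrightarrow> w \<in> verts G - X \<Longrightarrow>
      {u, w} \<in> edges G \<longleftrightarrow> {v, w} \<in> edges G"
  using assms unfolding cut_labels_def by blast+

text \<open>The cut \<open>X\<close> and its classes \<open>m\<close> stay fixed while the graph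
  grows: an operation that treats equally labelled vertices alike cannot split a class.\<close>

lemma cut_labels_transfer:
  assumes "cut_labels k G l X m" "verts G \<subseteq> verts G'"
    and "\<And>u v. u \<in> X \<Longrightarrow> v \<in> X \<Longrightarrow> l u = l v \<Longrightarrow> l' u = l' v"
    and "\<And>u v w. u \<in> X \<Longrightarrow> v \<in> X \<Longrightarrow> w \<in> verts G' - X \<Longrightarrow> l u = l v \<Longrightarrow>
      (w \<in> verts G \<Longrightarrow> {u, w} \<in> edges G \<longleftrightarrow> {v, w} \<in> edges G) \<Longrightarrow>
      {u, w} \<in> edges G' \<longleftrightarrow> {v, w} \<in> edges G'"
  shows "cut_labels k G' l' X m"
  unfolding cut_labels_def
proof (intro conjI ballI impI)
  show "X \<subseteq> verts G'" "m ` X \<subseteq> {1..k}"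
    using cut_labelsD(1,2)[OF assms(1)] assms(2) by blast+
next
  fix u v assume uv: "u \<in> X" "v \<in> X" "m u = m v"
  note l = cut_labelsD(3)[OF assms(1) uv] and e = cut_labelsD(4)[OF assms(1) uv]
  show "l' u = l' v" using uv l by (intro assms(3))
  fix w assume w: "w \<in> verts G' - X"
  show "{u, w} \<in> edges G' \<longleftrightarrow> {v, w} \<in> edges G'"
    by (rule assms(4)[OF uv(1,2) w l]) (use w e in blast)
qed

text \<open>Some union in the construction has more than \<open>t\<close> vertices of
  \<open>W\<close> while its two operands have at most \<open>t\<close> each. Its vertex set serves
  as \<open>X\<close> and its labels as \<open>m\<close>; later operations see only labels and
  preserve the classes.\<close>

lemma cw_constructible_balanced_labels:
  assumes "cw_constructible k G l" "1 \<le> t" "t < card (verts G \<inter> W)"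
  shows "\<exists>X m. cut_labels k G l X m \<and> t < card (X \<inter> W) \<and> card (X \<inter> W) \<le> 2 * t"
  using assms
proof (induction rule: cw_constructible.induct)
  case (vertex i v)
  \<comment> \<open>As \<open>1 \<le> t\<close>, a single vertex cannot exceed \<open>t\<close>, so
    this case is vacuous.\<close>
  have "card ({v} \<inter> W) \<le> card {v}" by (intro card_mono) auto
  with vertex show ?case by simp
next
  case (union G l H m)
  let ?GH = "\<lparr>verts = verts G \<union> verts H, edges = edges G \<union> edges H\<rparr>"
    and ?lm = "\<lambda>v. if v \<in> verts G then l v else m v"
  have G: "{u, w} \<in> edges G \<Longrightarrow> u \<in> verts G \<and> w \<in> verts G" "l ` verts G \<subseteq> {1..k}" for u w
    using cw_constructible_simple_graph[OF union.hyps(1)] by (auto simp: simple_graph_def)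
  have H: "{u, w} \<in> edges H \<Longrightarrow> u \<in> verts H \<and> w \<in> verts H" "m ` verts H \<subseteq> {1..k}" for u w
    using cw_constructible_simple_graph[OF union.hyps(2)] by (auto simp: simple_graph_def)
  have disj: "v \<notin> verts H" if "v \<in> verts G" for v
    using union.hyps(3) that by auto
  have nG: "{u, w} \<notin> edges G" if "u \<in> verts H \<or> w \<in> verts H" for u w
    using G(1)[of u w] disj that by blast
  have nH: "{u, w} \<notin> edges H" if "u \<in> verts G \<or> w \<in> verts G" for u w
    using H(1)[of u w] disj that by blast
  consider "t < card (verts G \<inter> W)" | "t < card (verts H \<inter> W)"
    | "card (verts G \<inter> W) \<le> t" "card (verts H \<inter> W) \<le> t" by linarith
  then show ?case
  proof cases
    case 1
    then obtain X q where X: "cut_labels k G l X q" "t < card (X \<inter> W)" "card (X \<inter> W) \<le> 2 * t"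
      using union.IH(1) union.prems(1) by blast
    have "X \<subseteq> verts G" by (rule cut_labelsD(1)[OF X(1)])
    then have "cut_labels k ?GH ?lm X q"
      by (intro cut_labels_transfer[OF X(1)]) (auto simp: nG nH subset_iff)
    with X show ?thesis by blast
  next
    case 2
    then obtain X q where X: "cut_labels k H m X q" "t < card (X \<inter> W)" "card (X \<inter> W) \<le> 2 * t"
      using union.IH(2) union.prems(1) by blast
    have "X \<subseteq> verts H" by (rule cut_labelsD(1)[OF X(1)])
    then have "cut_labels k ?GH ?lm X q"
      using disj by (intro cut_labels_transfer[OF X(1)]) (auto simp: nG nH subset_iff)
    with X show ?thesis by blast
  next
    case 3
    have "card ((verts G \<union> verts H) \<inter> W) \<le> 2 * t"
      using card_Un_le[of "verts G \<inter> W" "verts H \<inter> W"] 3 by (simp add: Int_Un_distrib2)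
    moreover have "?lm ` (verts G \<union> verts H) \<subseteq> {1..k}"
      using G(2) H(2) by auto
    \<comment> \<open>No vertex lies outside \<open>X\<close> at this moment, so the neighbourhood
      condition is vacuous.\<close>
    then have "cut_labels k ?GH ?lm (verts G \<union> verts H) ?lm"
      by (simp add: cut_labels_def)
    ultimately show ?thesis
      using union.prems(2) unfolding ugraph.simps by blast
  qed
next
  case (join G l i j)
  then obtain X q where X: "cut_labels k G l X q" "t < card (X \<inter> W)" "card (X \<inter> W) \<le> 2 * t"
    by auto
  have new: "{u, w} \<in> {{u, v} | u v. u \<in> verts G \<and> v \<in> verts G \<and> l u = i \<and> l v = j} \<longleftrightarrow>
      (l u = i \<and> l w = j \<or> l u = j \<and> l w = i)" if "u \<in> verts G" "w \<in> verts G" for u w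
    using that by (auto simp: doubleton_eq_iff)
  let ?E = "{{u, v} | u v. u \<in> verts G \<and> v \<in> verts G \<and> l u = i \<and> l v = j}"
  have "X \<subseteq> verts G" by (rule cut_labelsD(1)[OF X(1)])
  then have "cut_labels k \<lparr>verts = verts G, edges = edges G \<union> ?E\<rparr> l X q"
  proof (intro cut_labels_transfer[OF X(1)])
    fix u v w
    assume uv: "u \<in> X" "v \<in> X" "l u = l v"
      and "w \<in> verts \<lparr>verts = verts G, edges = edges G \<union> ?E\<rparr> - X"
      and e: "w \<in> verts G \<Longrightarrow> {u, w} \<in> edges G \<longleftrightarrow> {v, w} \<in> edges G"
    then have "u \<in> verts G" "v \<in> verts G" "w \<in> verts G"
      using \<open>X \<subseteq> verts G\<close> by auto
    then show "{u, w} \<in> edges \<lparr>verts = verts G, edges = edges G \<union> ?E\<rparr> \<longleftrightarrow>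
        {v, w} \<in> edges \<lparr>verts = verts G, edges = edges G \<union> ?E\<rparr>"
      unfolding ugraph.simps Un_iff by (simp only: new e uv)
  qed auto
  with X show ?case by blast
next
  case (relabel G l i j)
  then obtain X q where X: "cut_labels k G l X q" "t < card (X \<inter> W)" "card (X \<inter> W) \<le> 2 * t"
    by blast
  have "cut_labels k G (\<lambda>v. if l v = i then j else l v) X q"
    by (intro cut_labels_transfer[OF X(1)]) auto
  with X show ?case by blast
qed

lemma cw_constructible_balanced_cut:
  assumes "cw_constructible k G l" "1 \<le> t" "t < card (verts G \<inter> W)"
  obtains X where "X \<subseteq> verts G" "t < card (X \<inter> W)" "card (X \<inter> W) \<le> 2 * t" "cut_types_le G k X"
proof -
  obtain X m where m: "cut_labels k G l X m" and X: "t < card (X \<inter> W)" "card (X \<inter> W) \<le> 2 * t"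
    using cw_constructible_balanced_labels[OF assms] by blast
  have "cut_types_le G k X"
    unfolding cut_types_le_def
  proof (intro allI impI)
    fix S assume S: "S \<subseteq> X" and
      sep: "\<forall>u\<in>S. \<forall>v\<in>S. u \<noteq> v \<longrightarrow>
        (\<exists>w\<in>verts G - X. ({u, w} \<in> edges G) \<noteq> ({v, w} \<in> edges G))"
    have "inj_on m S"
    proof (rule inj_onI, rule ccontr)
      fix u v assume "u \<in> S" "v \<in> S" "m u = m v" "u \<noteq> v"
      with S sep obtain w where "w \<in> verts G - X" "({u, w} \<in> edges G) \<noteq> ({v, w} \<in> edges G)"
        by blast
      moreover have "u \<in> X" "v \<in> X" using S \<open>u \<in> S\<close> \<open>v \<in> S\<close> by auto
      ultimately show False
        using cut_labelsD(4)[OF m _ _ \<open>m u = m v\<close>] by blast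
    qed
    then have "card S \<le> card {1..k}"
      using S cut_labelsD(2)[OF m] by (intro card_inj_on_le[of m]) auto
    then show "card S \<le> k" by simp
  qed
  with cut_labelsD(1)[OF m] X show ?thesis by (rule that)
qed

text \<open>Think of hubs \<open>h i\<close> with tips \<open>q i j\<close>, each tip adjacent to
  its own hub only. A tip outside \<open>X\<close> tells its hub apart from all other hubs, and a
  hub outside \<open>X\<close> tells its tip apart from tips of other hubs. So at most
  \<open>k\<close> hubs are cut from some tip in either direction.\<close>

lemma cut_types_le_spokes:
  fixes h :: "'i \<Rightarrow> 'a" and q :: "'i \<Rightarrow> 'j \<Rightarrow> 'a"
  assumes cut: "cut_types_le G k X"
    and q: "\<And>i j. i \<in> I \<Longrightarrow> j \<in> J \<Longrightarrow> q i j \<in> verts G"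
    and h: "\<And>i. i \<in> I \<Longrightarrow> h i \<in> verts G"
    and adj: "\<And>i i' j. i \<in> I \<Longrightarrow> i' \<in> I \<Longrightarrow> j \<in> J \<Longrightarrow> {h i, q i' j} \<in> edges G \<longleftrightarrow> i = i'"
  shows "card {i\<in>I. h i \<in> X \<and> (\<exists>j\<in>J. q i j \<notin> X)} \<le> k"
    and "card {i\<in>I. h i \<notin> X \<and> (\<exists>j\<in>J. q i j \<in> X)} \<le> k"
proof -
  let ?A = "{i\<in>I. h i \<in> X \<and> (\<exists>j\<in>J. q i j \<notin> X)}"
  have "inj_on h ?A"
  proof (rule inj_onI)
    fix i i' assume i: "i \<in> ?A" "i' \<in> ?A" "h i = h i'"
    then obtain j where "j \<in> J" by blast
    then have "{h i, q i j} \<in> edges G" "{h i', q i j} \<in> edges G \<longleftrightarrow> i' = i"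
      using adj i(1,2) by blast+
    then show "i = i'" unfolding i(3) by blast
  qed
  moreover have "card (h ` ?A) \<le> k"
  proof (rule cut[unfolded cut_types_le_def, rule_format])
    fix u v assume "u \<in> h ` ?A" "v \<in> h ` ?A" "u \<noteq> v"
    then obtain i i' j where "i \<in> I" "i' \<in> I" "u = h i" "v = h i'" "j \<in> J" "q i j \<notin> X" "i \<noteq> i'"
      by blast
    then show "\<exists>w\<in>verts G - X. ({u, w} \<in> edges G) \<noteq> ({v, w} \<in> edges G)"
      using adj[of i i j] adj[of i' i j] q[of i j] by (intro bexI[of _ "q i j"]) simp_all
  qed auto
  ultimately show "card ?A \<le> k" by (simp add: card_image)
next
  let ?B = "{i\<in>I. h i \<notin> X \<and> (\<exists>j\<in>J. q i j \<in> X)}"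
  \<comment> \<open>Representatives must lie in \<open>X\<close>, so here one tip per hub is chosen
    as representative and the hubs do the distinguishing.\<close>
  obtain c where c: "\<And>i. i \<in> ?B \<Longrightarrow> c i \<in> J \<and> q i (c i) \<in> X"
    by (rule that[of "\<lambda>i. SOME j. j \<in> J \<and> q i j \<in> X"]) (rule someI_ex, blast)
  let ?q = "\<lambda>i. q i (c i)"
  have adj': "{?q i, h i'} \<in> edges G \<longleftrightarrow> i' = i" if "i \<in> ?B" "i' \<in> ?B" for i i'
    using adj[of i' i "c i"] c[OF that(1)] that by (simp add: insert_commute[of "?q i"])
  have "inj_on ?q ?B"
  proof (rule inj_onI)
    fix i i' assume "i \<in> ?B" "i' \<in> ?B" "?q i = ?q i'"
    then show "i = i'" using adj'[of i i] adj'[of i' i] by metis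
  qed
  moreover have "card (?q ` ?B) \<le> k"
  proof (rule cut[unfolded cut_types_le_def, rule_format])
    fix u v assume "u \<in> ?q ` ?B" "v \<in> ?q ` ?B" "u \<noteq> v"
    then obtain i i' where i: "i \<in> ?B" "i' \<in> ?B" "u = ?q i" "v = ?q i'" "i \<noteq> i'"
      by blast
    then have "{u, h i} \<in> edges G" "{v, h i} \<notin> edges G" "h i \<in> verts G - X"
      using adj'[of i i] adj'[of i' i] h[of i] by auto
    then show "\<exists>w\<in>verts G - X. ({u, w} \<in> edges G) \<noteq> ({v, w} \<in> edges G)"
      by blast
  qed (use c in auto)
  ultimately show "card ?B \<le> k" by (simp add: card_image)
qed

section \<open>The triangulated complete bipartite graph\<close>

text \<open>
  For \<open>a, b > 0\<close> the pair \<open>(a, 0)\<close> is a row, \<open>(0, b)\<close> a column, and \<open>(a, b)\<close> the apex of the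
  triangle glued onto the edge between them. The pair \<open>(0, 0)\<close> is not a vertex.
\<close>

definition tri_adj :: "nat \<times> nat \<Rightarrow> nat \<times> nat \<Rightarrow> bool" where
  "tri_adj u v \<longleftrightarrow> u \<noteq> v \<and> (\<exists>a>0. \<exists>b>0. {u, v} \<subseteq> {(a, 0), (0, b), (a, b)})"

definition tri_verts :: "nat \<Rightarrow> (nat \<times> nat) set" where
  "tri_verts n = {..n} \<times> {..n} - {(0, 0)}"

text \<open>\<open>prod_encode\<close> moves the vertices into \<open>nat\<close>, the vertex type
  of the class in the final theorem.\<close>

definition tri_graph :: "nat \<Rightarrow> nat ugraph" where
  "tri_graph n = \<lparr>verts = prod_encode ` tri_verts n,
     edges = {{prod_encode u, prod_encode v} | u v.
       u \<in> tri_verts n \<and> v \<in> tri_verts n \<and> tri_adj u v}\<rparr>"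

lemma tri_adj_sym: "tri_adj u v \<longleftrightarrow> tri_adj v u"
  by (auto simp: tri_adj_def)

lemma verts_tri_graph: "verts (tri_graph n) = prod_encode ` tri_verts n"
  by (simp add: tri_graph_def)

lemma edges_tri_graph:
  assumes "u \<in> tri_verts n" "v \<in> tri_verts n"
  shows "{prod_encode u, prod_encode v} \<in> edges (tri_graph n) \<longleftrightarrow> tri_adj u v"
  using assms tri_adj_sym[of u v] unfolding tri_graph_def ugraph.simps mem_Collect_eq
  by (auto simp: doubleton_eq_iff simp del: split_paired_Ex)

lemma simple_tri_graph: "simple_graph (tri_graph n)"
  by (auto simp: simple_graph_def tri_graph_def tri_verts_def tri_adj_def card_insert_if)

text \<open>Rows, columns and apexes each form an independent set, so a triangle is a row, a column
  and their apex, and any two of these determine the third.\<close>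

lemma tri_adj_diamond:
  assumes "tri_adj u v" "tri_adj x u" "tri_adj x v" "tri_adj y u" "tri_adj y v"
  shows "x = y"
  using assms by (auto simp: tri_adj_def)

lemma tri_adj_iff:
  "tri_adj (a, b) (c, d) \<longleftrightarrow>
    (0 < a \<and> b = 0 \<and> c = 0 \<and> 0 < d) \<or> (a = 0 \<and> 0 < b \<and> 0 < c \<and> d = 0) \<or>
    (0 < a \<and> 0 < b \<and> (c = a \<and> d = 0 \<or> c = 0 \<and> d = b)) \<or>
    (0 < c \<and> 0 < d \<and> (a = c \<and> b = 0 \<or> a = 0 \<and> b = d))"
  by (auto simp: tri_adj_def)

text \<open>Without the columns each apex keeps only its row as a neighbour. What remains is a
  disjoint union of stars, which contains no path on four vertices. The case of rows is
  symmetric.\<close>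

lemma tri_adj_P4_meets_columns:
  assumes "tri_adj x y" "tri_adj y z" "tri_adj z w" "x \<noteq> z" "y \<noteq> w"
  shows "\<exists>s\<in>{x, y, z, w}. fst s = 0"
  using assms by (cases x; cases y; cases z; cases w) (auto simp: tri_adj_iff)

lemma tri_adj_P4_meets_rows:
  assumes "tri_adj x y" "tri_adj y z" "tri_adj z w" "x \<noteq> z" "y \<noteq> w"
  shows "\<exists>s\<in>{x, y, z, w}. snd s = 0"
  using assms by (cases x; cases y; cases z; cases w) (auto simp: tri_adj_iff)

text \<open>The path contains a column and a row. Every edge has a row or a column as an end, and
  each row is adjacent to each column.\<close>

lemma tri_adj_P2_P4:
  assumes "tri_adj u v"
    and path: "tri_adj x y" "tri_adj y z" "tri_adj z w" "x \<noteq> z" "y \<noteq> w"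
  shows "\<exists>s\<in>{x, y, z, w}. tri_adj u s \<or> tri_adj v s"
proof -
  obtain s where s: "s \<in> {x, y, z, w}" "fst s = 0"
    using tri_adj_P4_meets_columns[OF path] by blast
  obtain t where t: "t \<in> {x, y, z, w}" "snd t = 0"
    using tri_adj_P4_meets_rows[OF path] by blast
  \<comment> \<open>A zero coordinate alone would also admit the non-vertex \<open>(0, 0)\<close>,
    which is isolated in \<open>tri_adj\<close>.\<close>
  have "s' \<noteq> (0, 0)" if "s' \<in> {x, y, z, w}" for s'
    using path(1,3) that by (auto simp: tri_adj_def)
  with s t obtain b a where ba: "s = (0, b)" "0 < b" "t = (a, 0)" "0 < a"
    by (metis gr0I prod.collapse)
  have "fst u = 0 \<and> 0 < snd u \<or> fst v = 0 \<and> 0 < snd v \<or>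
      snd u = 0 \<and> 0 < fst u \<or> snd v = 0 \<and> 0 < fst v"
    using assms(1) by (cases u; cases v) (auto simp: tri_adj_iff)
  then have "tri_adj u s \<or> tri_adj v s \<or> tri_adj u t \<or> tri_adj v t"
    using ba by (cases u; cases v) (auto simp: tri_adj_iff)
  with s(1) t(1) show ?thesis by blast
qed

section \<open>Induced subgraphs\<close>

lemma not_graph_freeE:
  assumes "\<not> graph_free H G"
  obtains g where "inj_on g (verts H)" "g ` verts H \<subseteq> verts G"
    "\<And>a b. a \<in> verts H \<Longrightarrow> b \<in> verts H \<Longrightarrow> {g a, g b} \<in> edges G \<longleftrightarrow> {a, b} \<in> edges H"
proof -
  obtain S f where S: "S \<subseteq> verts G" and f: "bij_betw f S (verts H)"
    and e: "\<And>u v. u \<in> S \<Longrightarrow> v \<in> S \<Longrightarrow> {u, v} \<in> edges G \<longleftrightarrow> {f u, f v} \<in> edges H"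
    using assms by (auto simp: graph_free_def graph_iso_def induced_subgraph_def)
  let ?g = "inv_into S f"
  have g: "bij_betw ?g (verts H) S"
    using f by (rule bij_betw_inv_into)
  have mem: "?g a \<in> S" "f (?g a) = a" if "a \<in> verts H" for a
    using g bij_betw_inv_into_right[OF f that] that by (auto simp: bij_betw_def)
  show ?thesis
  proof (rule that[of ?g])
    show "inj_on ?g (verts H)" "?g ` verts H \<subseteq> verts G"
      using g S by (auto simp: bij_betw_def)
  qed (use mem e in simp)
qed

lemma edges_path_graph:
  "{i, j} \<in> edges (path_graph r) \<longleftrightarrow> i < r \<and> j < r \<and> (j = Suc i \<or> i = Suc j)"
  by (auto simp: path_graph_def doubleton_eq_iff)

lemma edges_disjoint_union:
  "{Inl a, Inl b} \<in> edges (disjoint_union G H) \<longleftrightarrow> {a, b} \<in> edges G"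
  "{Inr c, Inr d} \<in> edges (disjoint_union G H) \<longleftrightarrow> {c, d} \<in> edges H"
  "{Inl a, Inr c} \<notin> edges (disjoint_union G H)"
proof -
  have "{Inl a, Inl b} \<in> (`) Inl ` E \<longleftrightarrow> {a, b} \<in> E" for E :: "'a set set"
    using inj_image_mem_iff[of "(`) Inl" "{a, b}" E] by (simp add: inj_def inj_image_eq_iff)
  moreover have "{Inl a, Inl b} \<notin> (`) Inr ` E" for E :: "'b set set"
    by auto
  ultimately show "{Inl a, Inl b} \<in> edges (disjoint_union G H) \<longleftrightarrow> {a, b} \<in> edges G"
    by (simp add: disjoint_union_def)
  have "{Inr c, Inr d} \<in> (`) Inr ` E \<longleftrightarrow> {c, d} \<in> E" for E :: "'b set set"
    using inj_image_mem_iff[of "(`) Inr" "{c, d}" E] by (simp add: inj_def inj_image_eq_iff)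
  moreover have "{Inr c, Inr d} \<notin> (`) Inl ` E" for E :: "'a set set"
    by auto
  ultimately show "{Inr c, Inr d} \<in> edges (disjoint_union G H) \<longleftrightarrow> {c, d} \<in> edges H"
    by (simp add: disjoint_union_def)
  show "{Inl a, Inr c} \<notin> edges (disjoint_union G H)"
    by (auto simp: disjoint_union_def)
qed

text \<open>Decodes a copy of \<open>H\<close> to pairs, where the facts about
  \<open>tri_adj\<close> apply.\<close>

lemma tri_graph_copyE:
  assumes "\<not> graph_free H (tri_graph n)"
  obtains g where "inj_on g (verts H)"
    "\<And>a b. a \<in> verts H \<Longrightarrow> b \<in> verts H \<Longrightarrow> tri_adj (g a) (g b) \<longleftrightarrow> {a, b} \<in> edges H"
proof -
  obtain g where g: "inj_on g (verts H)" "g ` verts H \<subseteq> prod_encode ` tri_verts n"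
    "\<And>a b. a \<in> verts H \<Longrightarrow> b \<in> verts H \<Longrightarrow> {g a, g b} \<in> edges (tri_graph n) \<longleftrightarrow> {a, b} \<in> edges H"
    using not_graph_freeE[OF assms] unfolding verts_tri_graph by blast
  have dec: "prod_decode (g a) \<in> tri_verts n" if "a \<in> verts H" for a
    using g(2) that by auto
  show ?thesis
  proof (rule that[of "prod_decode \<circ> g"])
    show "inj_on (prod_decode \<circ> g) (verts H)"
      using g(1) inj_prod_decode by (rule comp_inj_on)
  next
    fix a b assume "a \<in> verts H" "b \<in> verts H"
    then show "tri_adj ((prod_decode \<circ> g) a) ((prod_decode \<circ> g) b) \<longleftrightarrow> {a, b} \<in> edges H"
      using edges_tri_graph[OF dec dec, of a b] g(3) by simp
  qed
qed

lemma tri_graph_diamond_free: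
  "graph_free (complement_graph (disjoint_union (copies 2 (path_graph 1)) (path_graph 2)))
     (tri_graph n)" (is "graph_free ?H _")
proof (rule ccontr)
  assume "\<not> ?thesis"
  then obtain g where inj: "inj_on g (verts ?H)"
    and e: "\<And>a b. a \<in> verts ?H \<Longrightarrow> b \<in> verts ?H \<Longrightarrow> tri_adj (g a) (g b) \<longleftrightarrow> {a, b} \<in> edges ?H"
    by (rule tri_graph_copyE) blast
  \<comment> \<open>\<open>?c\<close> and \<open>?d\<close>, the ends of the
    \<open>P\<^sub>2\<close>, are the only nonadjacent pair of the diamond; \<open>?a\<close> and
    \<open>?b\<close> span the edge that its two triangles share.\<close>
  let ?a = "Inl (0, 0) :: nat \<times> nat + nat" and ?b = "Inl (1, 0) :: nat \<times> nat + nat"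
    and ?c = "Inr 0 :: nat \<times> nat + nat" and ?d = "Inr 1 :: nat \<times> nat + nat"
  have V: "?a \<in> verts ?H" "?b \<in> verts ?H" "?c \<in> verts ?H" "?d \<in> verts ?H"
    by (auto simp: complement_graph_def disjoint_union_def copies_def path_graph_def)
  have E: "{?a, ?b} \<in> edges ?H" "{?c, ?a} \<in> edges ?H" "{?c, ?b} \<in> edges ?H"
    "{?d, ?a} \<in> edges ?H" "{?d, ?b} \<in> edges ?H"
    by (auto simp: complement_graph_def disjoint_union_def copies_def path_graph_def card_insert_if
        doubleton_eq_iff)
  have "g ?c = g ?d"
    using E by (intro tri_adj_diamond[of "g ?a" "g ?b"]) (simp_all only: e V)
  with inj V show False by (auto dest: inj_onD)
qed

lemma tri_graph_P2_P4_free: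
  "graph_free (disjoint_union (path_graph 2) (path_graph 4)) (tri_graph n)" (is "graph_free ?H _")
proof (rule ccontr)
  assume "\<not> ?thesis"
  then obtain g where inj: "inj_on g (verts ?H)"
    and e: "\<And>a b. a \<in> verts ?H \<Longrightarrow> b \<in> verts ?H \<Longrightarrow> tri_adj (g a) (g b) \<longleftrightarrow> {a, b} \<in> edges ?H"
    by (rule tri_graph_copyE) blast
  have V: "Inl 0 \<in> verts ?H" "Inl 1 \<in> verts ?H" "Inr 0 \<in> verts ?H" "Inr 1 \<in> verts ?H"
    "Inr 2 \<in> verts ?H" "Inr 3 \<in> verts ?H"
    by (auto simp: disjoint_union_def path_graph_def)
  have "g (Inr 0) \<noteq> g (Inr 2)" "g (Inr 1) \<noteq> g (Inr 3)"
    using inj V by (auto dest: inj_onD)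
  then have "\<exists>s\<in>{g (Inr 0), g (Inr 1), g (Inr 2), g (Inr 3)}. tri_adj (g (Inl 0)) s \<or> tri_adj (g (Inl 1)) s"
    by (intro tri_adj_P2_P4) (simp_all add: e V[unfolded One_nat_def] edges_disjoint_union edges_path_graph)
  then show False by (auto simp: e V[unfolded One_nat_def] edges_disjoint_union)
qed

section \<open>Unbounded clique-width\<close>

lemma tri_graph_not_constructible:
  assumes "cw_constructible k (tri_graph n) l" "3 * Suc k \<le> n"
  shows False
proof -
  let ?G = "tri_graph n" and ?I = "{1..n}"
  define r c p where "r = (\<lambda>a. prod_encode (a, 0))" and "c = (\<lambda>b. prod_encode (0, b))"
    and "p = (\<lambda>a b. prod_encode (a, b))"
  have V: "\<And>a. a \<in> ?I \<Longrightarrow> r a \<in> verts ?G" "\<And>b. b \<in> ?I \<Longrightarrow> c b \<in> verts ?G"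
    "\<And>a b. a \<in> ?I \<Longrightarrow> b \<in> ?I \<Longrightarrow> p a b \<in> verts ?G"
    by (auto simp: verts_tri_graph tri_verts_def r_def c_def p_def)
  have rp: "{r a, p a' b} \<in> edges ?G \<longleftrightarrow> a = a'" and cp: "{c a, p b a'} \<in> edges ?G \<longleftrightarrow> a = a'"
    if "a \<in> ?I" "a' \<in> ?I" "b \<in> ?I" for a a' b
    unfolding r_def c_def p_def
    by (subst edges_tri_graph; use that in \<open>auto simp: tri_verts_def tri_adj_def\<close>)+
  have "inj_on r ?I" by (auto simp: inj_on_def r_def)
  then have card_r: "card (r ` S) = card S" if "S \<subseteq> ?I" for S
    using that by (meson card_image inj_on_subset)
  have "verts ?G \<inter> r ` ?I = r ` ?I" using V by auto
  then have "Suc k < card (verts ?G \<inter> r ` ?I)" using assms(2) card_r[of ?I] by simp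
  \<comment> \<open>With \<open>t = Suc k\<close> there are more than \<open>Suc k\<close> rows
    inside \<open>X\<close> and at least \<open>n - 2 * Suc k\<close>, hence at least
    \<open>Suc k\<close>, outside: on both sides more than the \<open>k\<close> possible
    exceptions.\<close>
  from cw_constructible_balanced_cut[OF assms(1) _ this]
  obtain X where X: "Suc k < card (X \<inter> r ` ?I)" "card (X \<inter> r ` ?I) \<le> 2 * Suc k"
    and cut: "cut_types_le ?G k X" by auto
  \<comment> \<open>Rows, and then columns, are the hubs; their tips are the apexes.\<close>
  have row: "card {a\<in>?I. r a \<in> X \<and> (\<exists>b\<in>?I. p a b \<notin> X)} \<le> k"
    "card {a\<in>?I. r a \<notin> X \<and> (\<exists>b\<in>?I. p a b \<in> X)} \<le> k"
    by (rule cut_types_le_spokes[OF cut]; fact V rp)+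
  have col: "card {b\<in>?I. c b \<in> X \<and> (\<exists>a\<in>?I. p a b \<notin> X)} \<le> k"
    "card {b\<in>?I. c b \<notin> X \<and> (\<exists>a\<in>?I. p a b \<in> X)} \<le> k"
    by (rule cut_types_le_spokes[OF cut, where q = "\<lambda>b a. p a b"]; simp only: V cp)+
  have exc: "\<exists>i\<in>S. i \<notin> T" if "card T \<le> m" "m < card S" "T \<subseteq> ?I" for S T :: "nat set" and m
    using that card_mono[of T S] finite_subset[of T ?I] by fastforce
  have "X \<inter> r ` ?I = r ` {a\<in>?I. r a \<in> X}" by auto
  then have card_in: "card (X \<inter> r ` ?I) = card {a\<in>?I. r a \<in> X}"
    by (simp only: card_r[OF Collect_restrict])
  have "\<exists>a\<in>{a\<in>?I. r a \<in> X}. a \<notin> {a\<in>?I. r a \<in> X \<and> (\<exists>b\<in>?I. p a b \<notin> X)}"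
    by (rule exc[OF row(1)]) (use X(1) in \<open>unfold card_in, auto\<close>)
  then obtain a where a: "a \<in> ?I" "\<And>b. b \<in> ?I \<Longrightarrow> p a b \<in> X" by blast
  have "card {a\<in>?I. r a \<notin> X} = card (?I - {a\<in>?I. r a \<in> X})"
    by (rule arg_cong[of _ _ card]) blast
  also have "\<dots> = n - card {a\<in>?I. r a \<in> X}"
    by (subst card_Diff_subset) auto
  finally have "\<exists>a\<in>{a\<in>?I. r a \<notin> X}. a \<notin> {a\<in>?I. r a \<notin> X \<and> (\<exists>b\<in>?I. p a b \<in> X)}"
    by (intro exc[OF row(2)]) (use X(2) assms(2) in \<open>unfold card_in, auto\<close>)
  then obtain a' where a': "a' \<in> ?I" "\<And>b. b \<in> ?I \<Longrightarrow> p a' b \<notin> X" by blast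
  let ?C = "{b\<in>?I. c b \<in> X \<and> (\<exists>a\<in>?I. p a b \<notin> X)}" and ?D = "{b\<in>?I. c b \<notin> X \<and> (\<exists>a\<in>?I. p a b \<in> X)}"
  have "card (?C \<union> ?D) \<le> 2 * k"
    using card_Un_le[of ?C ?D] col by linarith
  then have "\<exists>b\<in>?I. b \<notin> ?C \<union> ?D"
    by (rule exc) (use assms(2) in auto)
  \<comment> \<open>The apex \<open>p a b\<close> is inside \<open>X\<close> and
    \<open>p a' b\<close> outside, so \<open>b\<close> belongs to \<open>?C\<close> or to
    \<open>?D\<close> according to the side of \<open>c b\<close>.\<close>
  then show False using a a' by blast
qed

theorem theorem1:
  "\<not> bounded_clique_width
     {G :: nat ugraph. simple_graph G \<and>
        graph_free (complement_graph (disjoint_union (copies 2 (path_graph 1)) (path_graph 2))) G \<and>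
        graph_free (disjoint_union (path_graph 2) (path_graph 4)) G}"
  (is "\<not> bounded_clique_width ?\<G>")
proof
  assume "bounded_clique_width ?\<G>"
  then obtain c where "\<forall>G\<in>?\<G>. clique_width G \<le> c"
    unfolding bounded_clique_width_def by (rule exE)
  then have c: "clique_width (tri_graph n) \<le> c" for n
    by (rule bspec) (simp only: mem_Collect_eq simple_tri_graph tri_graph_diamond_free
        tri_graph_P2_P4_free simp_thms)
  let ?G = "tri_graph (3 * Suc c)"
  have "(1, 0) \<in> tri_verts (3 * Suc c)" by (simp add: tri_verts_def)
  \<comment> \<open>Only for a nonempty set is the infimum attained; \<open>Inf {}\<close> would be
    the default 0.\<close>
  then have "{k. \<exists>l. cw_constructible k ?G l} \<noteq> {}"
    using cw_constructible_exists[OF simple_tri_graph, of "3 * Suc c"] by (auto simp: verts_tri_graph)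
  then have "clique_width ?G \<in> {k. \<exists>l. cw_constructible k ?G l}"
    unfolding clique_width_def by (rule Inf_nat_def1)
  then obtain l where "cw_constructible (clique_width ?G) ?G l"
    by blast
  then show False
    by (rule tri_graph_not_constructible) (use c in simp)
qed

end
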